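(* (Generalized Borel's theorem) For any open subset $U$ of a Euclidean space and any family of smooth functions $\{f_i:U\to\mathbb{R}\}_{i\in\mathbb{N}}$, there exists a smooth map $d:U\times\mathbb{R}\to\mathbb{R}$, $(x,y)\mapsto d(x,y)$, such that $\frac{\partial^k d}{\partial y^k}(x,0)=f_k(x)$ for all $k\in\mathbb{N}$ and all $x\in U$.
   Context: Here $\mathbb{N}=\{0,1,2,\dots\}$ and smooth means $C^\infty$ in the usual sense. *)

theory Defs
  imports "HOL-Analysis.Analysis"
begin

(* Meant for open S only, since the derivatives are taken at interior points.
   For k = Suc n the second conjunct says that every directional derivative is again
   of class C^n; over a finite-dimensional space this is the usual C^k. *)
fun Ck_on :: "nat \<Rightarrow> ('a::real_normed_vector \<Rightarrow> 'b::real_normed_vector) \<Rightarrow> 'a set \<Rightarrow> bool" where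
  "Ck_on 0 f S \<longleftrightarrow> continuous_on S f"
| "Ck_on (Suc n) f S \<longleftrightarrow>
     (\<forall>x\<in>S. f differentiable (at x)) \<and>
     (\<forall>v. Ck_on n (\<lambda>x. frechet_derivative f (at x) v) S)"

definition smooth_on :: "'a::real_normed_vector set \<Rightarrow> ('a \<Rightarrow> 'b::real_normed_vector) \<Rightarrow> bool" where
  "smooth_on S f \<longleftrightarrow> (\<forall>n. Ck_on n f S)"

(* The class euclidean_space excludes the zero-dimensional space (its Basis is nonempty).
   A Euclidean space is therefore rendered as a type of class real_inner satisfying the
   following predicate, so that dimension zero (the classical lemma of Borel) is covered. *)
definition finite_dimensional :: "'a::real_vector itself \<Rightarrow> bool" where
  "finite_dimensional _ \<longleftrightarrow> (\<exists>B::'a set. finite B \<and> span B = UNIV)"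

end

theory Submission
  imports Defs
begin

text \<open>
  Seek \<open>d (x, y) = (\<Sum>k. g k x * H k y)\<close> with \<open>H k y = sin (t y) ^ k / (k! t ^ k)\<close> for a large
  constant \<open>t\<close> depending on \<open>k\<close>. All derivatives of \<open>H k\<close> are bounded on the whole line, so no
  cut-off function is needed, and those of order \<open>j < k\<close> are \<open>O(1/t)\<close>. Exhausting \<open>U\<close> by compact
  sets \<open>K k\<close>, one can choose \<open>t\<close> such that the derivatives of order less than \<open>k\<close> of the \<open>k\<close>-th term
  are at most \<open>2 ^ (- k)\<close> on \<open>K k \<times> \<real>\<close>; hence the series converges locally uniformly with all its
  derivatives. At \<open>0\<close> the derivatives of \<open>H k\<close> of order \<open>j\<close> vanish for \<open>j < k\<close> and equal \<open>1\<close> for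
  \<open>j = k\<close>, but need not vanish for \<open>j > k\<close>. The prescribed values therefore form a unitriangular
  system, solved by subtracting from \<open>f k\<close> the contributions of the \<open>g i\<close> with \<open>i < k\<close>; as \<open>t\<close> depends
  on \<open>g k\<close>, the coefficients and the scales are chosen in one recursion.
\<close>

section \<open>Closure properties of C^k functions\<close>

text \<open>On an open set \<open>has_derivative\<close> depends only on nearby values;
  \<open>frechet_derivative\<close> is a choice from that predicate, so the chosen maps agree
  too.\<close>

lemma Ck_on_cong:
  assumes "open S" "\<And>x. x \<in> S \<Longrightarrow> f x = g x"
  shows "Ck_on n f S \<longleftrightarrow> Ck_on n g S"
  using assms(2)
proof (induction n arbitrary: f g)
  case 0
  then show ?case by (simp cong: continuous_on_cong)
next
  case (Suc n)
  have deriv: "(f has_derivative f') (at x) \<longleftrightarrow> (g has_derivative f') (at x)" if "x \<in> S" for x f'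
    using Suc.prems assms(1) that
    by (auto intro: has_derivative_transform_within_open[OF _ assms(1)])
  then have "f differentiable (at x) \<longleftrightarrow> g differentiable (at x)"
    "frechet_derivative f (at x) = frechet_derivative g (at x)" if "x \<in> S" for x
    using that by (simp_all add: differentiable_def frechet_derivative_def)
  then show ?case
    using Suc.IH[of "\<lambda>x. frechet_derivative f (at x) v" "\<lambda>x. frechet_derivative g (at x) v" for v]
    by simp
qed

text \<open>By uniqueness of derivatives, an explicit formula may stand for the chosen
  \<open>frechet_derivative\<close>.\<close>

lemma Ck_on_Suc_has_derivative:
  assumes "open S"
    and "\<And>x. x \<in> S \<Longrightarrow> (f has_derivative f' x) (at x)"
    and "\<And>v. Ck_on n (\<lambda>x. f' x v) S"
  shows "Ck_on (Suc n) f S"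
proof -
  have "frechet_derivative f (at x) = f' x" if "x \<in> S" for x
    using frechet_derivative_at[OF assms(2)[OF that]] by simp
  then have "Ck_on n (\<lambda>x. frechet_derivative f (at x) v) S" for v
    using Ck_on_cong[OF assms(1), of "\<lambda>x. frechet_derivative f (at x) v" "\<lambda>x. f' x v" n]
      assms(3) by simp
  then show ?thesis
    using assms(2) by (auto simp: differentiable_def)
qed

lemma Ck_on_const: "Ck_on n (\<lambda>x. c) S"
  by (induction n arbitrary: c) (auto simp: frechet_derivative_const)

lemma Ck_on_add:
  assumes "open S" "Ck_on n f S" "Ck_on n g S"
  shows "Ck_on n (\<lambda>x. f x + g x) S"
  using assms(2,3)
proof (induction n arbitrary: f g)
  case 0
  then show ?case by (simp add: continuous_on_add)
next
  case (Suc n)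
  show ?case
  proof (rule Ck_on_Suc_has_derivative[OF assms(1)])
    show "((\<lambda>x. f x + g x) has_derivative
        (\<lambda>v. frechet_derivative f (at x) v + frechet_derivative g (at x) v)) (at x)" if "x \<in> S" for x
      using Suc.prems that by (auto intro!: has_derivative_add simp: frechet_derivative_works[symmetric])
  qed (use Suc in auto)
qed

lemma Ck_on_scaleR:
  assumes "open S" "Ck_on n f S"
  shows "Ck_on n (\<lambda>x. c *\<^sub>R f x) S"
  using assms(2)
proof (induction n arbitrary: f)
  case 0
  then show ?case by (simp add: continuous_on_scaleR)
next
  case (Suc n)
  show ?case
  proof (rule Ck_on_Suc_has_derivative[OF assms(1)])
    show "((\<lambda>x. c *\<^sub>R f x) has_derivative
        (\<lambda>v. c *\<^sub>R frechet_derivative f (at x) v)) (at x)" if "x \<in> S" for x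
      using Suc.prems that
      by (auto intro!: has_derivative_scaleR_right simp: frechet_derivative_works[symmetric])
  qed (use Suc in auto)
qed

lemma Ck_on_sum:
  assumes "open S" "\<And>i. i \<in> I \<Longrightarrow> Ck_on n (f i) S"
  shows "Ck_on n (\<lambda>x. \<Sum>i\<in>I. f i x) S"
  using assms(2)
proof (induction I rule: infinite_finite_induct)
  case (insert i I)
  then show ?case
    by (simp add: Ck_on_add[OF assms(1)])
qed (simp_all add: Ck_on_const)

section \<open>Bounded functions of one variable with prescribed leading jet at 0\<close>

text \<open>Quarter-period shifts give all derivatives of sine by one formula.\<close>

lemma sin_shift_deriv:
  "((\<lambda>y. sin (y + real j * (pi / 2))) has_real_derivative sin (y + real (Suc j) * (pi / 2))) (at y)"
proof -
  have "y + real (Suc j) * (pi / 2) = (y + real j * (pi / 2)) + pi / 2"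
    by (simp add: algebra_simps add_divide_distrib)
  then have "sin (y + real (Suc j) * (pi / 2)) = cos (y + real j * (pi / 2))"
    by (simp only: sin_add) simp
  then show ?thesis
    by (auto intro!: derivative_eq_intros)
qed

text \<open>Pascal's rule. With \<open>a\<close> and \<open>b\<close> the derivatives of two factors
  at a point, it turns the derivative of the Leibniz sum of order \<open>j\<close> into the sum of
  order \<open>j + 1\<close>.\<close>

lemma leibniz_step:
  fixes a b :: "nat \<Rightarrow> real"
  shows "(\<Sum>i\<le>j. real (j choose i) * (a (Suc i) * b (j - i) + a i * b (Suc (j - i)))) =
    (\<Sum>i\<le>Suc j. real (Suc j choose i) * (a i * b (Suc j - i)))"
proof -
  have "(\<Sum>i\<le>Suc j. real (Suc j choose i) * (a i * b (Suc j - i))) =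
     a 0 * b (Suc j) + (\<Sum>i\<le>j. real (Suc j choose Suc i) * (a (Suc i) * b (j - i)))"
    by (subst sum.atMost_Suc_shift) simp
  also have "\<dots> = (\<Sum>i\<le>j. real (j choose i) * (a (Suc i) * b (j - i))) +
     (a 0 * b (Suc j) + (\<Sum>i\<le>j. real (j choose Suc i) * (a (Suc i) * b (j - i))))"
    by (simp add: algebra_simps sum.distrib)
  also have "a 0 * b (Suc j) + (\<Sum>i\<le>j. real (j choose Suc i) * (a (Suc i) * b (j - i))) =
     (\<Sum>i\<le>Suc j. real (j choose i) * (a i * b (Suc j - i)))"
    by (simp only: sum.atMost_Suc_shift[of "\<lambda>i. real (j choose i) * (a i * b (Suc j - i))"]) simp
  also have "\<dots> = (\<Sum>i\<le>j. real (j choose i) * (a i * b (Suc (j - i))))"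
    by (simp add: Suc_diff_le)
  finally show ?thesis
    by (simp add: algebra_simps sum.distrib)
qed

text \<open>The witness is \<open>\<eta> j\<close> = the \<open>j\<close>-th derivative of \<open>sin ^ k / k!\<close>, built by the Leibniz rule.\<close>

lemma bounded_tower_exists:
  "\<exists>\<eta>::nat \<Rightarrow> real \<Rightarrow> real.
     (\<forall>j y. (\<eta> j has_real_derivative \<eta> (Suc j) y) (at y)) \<and>
     (\<forall>j. \<exists>A. \<forall>y. \<bar>\<eta> j y\<bar> \<le> A) \<and> (\<forall>j<k. \<eta> j 0 = 0) \<and> \<eta> k 0 = 1"
proof (induction k)
  case 0
  show ?case
    by (rule exI[of _ "\<lambda>j y. if j = 0 then 1 else 0"]) auto
next
  case (Suc k)
  then obtain \<eta> :: "nat \<Rightarrow> real \<Rightarrow> real"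
    where deriv: "\<And>j y. (\<eta> j has_real_derivative \<eta> (Suc j) y) (at y)"
      and bdd: "\<And>j. \<exists>A. \<forall>y. \<bar>\<eta> j y\<bar> \<le> A"
      and zero: "\<And>j. j < k \<Longrightarrow> \<eta> j 0 = 0" and one: "\<eta> k 0 = 1"
    by blast
  define s where "s = (\<lambda>j y. sin (y + real j * (pi / 2)))"
  have s_deriv: "(s j has_real_derivative s (Suc j) y) (at y)" for j y
    unfolding s_def by (rule sin_shift_deriv)
  define \<theta> where "\<theta> j y = (\<Sum>i\<le>j. real (j choose i) * (\<eta> i y * s (j - i) y)) / real (Suc k)" for j y
  have "(\<theta> j has_real_derivative \<theta> (Suc j) y) (at y)" for j y
  proof -
    have "(\<theta> j has_real_derivative
        (\<Sum>i\<le>j. real (j choose i) * (\<eta> (Suc i) y * s (j - i) y + \<eta> i y * s (Suc (j - i)) y)) / real (Suc k)) (at y)"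
      unfolding \<theta>_def
      by (intro DERIV_cdivide DERIV_sum DERIV_cmult)
        (rule derivative_eq_intros deriv s_deriv refl | simp add: algebra_simps)+
    then show ?thesis
      unfolding leibniz_step[of j "\<lambda>i. \<eta> i y" "\<lambda>i. s i y"] by (simp only: \<theta>_def)
  qed
  moreover have "\<exists>A. \<forall>y. \<bar>\<theta> j y\<bar> \<le> A" for j
  proof -
    from bdd obtain A where A: "\<And>i y. \<bar>\<eta> i y\<bar> \<le> A i" by metis
    have "\<bar>real (j choose i) * (\<eta> i y * s (j - i) y)\<bar> \<le> real (j choose i) * (A i * 1)" for i y
      unfolding abs_mult using A[of i y]
      by (intro mult_mono) (auto simp: s_def)
    then have "\<bar>\<theta> j y\<bar> \<le> (\<Sum>i\<le>j. real (j choose i) * (A i * 1)) / real (Suc k)" for y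
      unfolding \<theta>_def abs_divide
      by (intro divide_mono order.trans[OF sum_abs] sum_mono) (auto intro: sum_nonneg)
    then show ?thesis by blast
  qed
  moreover have "\<theta> j 0 = 0" if "j < Suc k" for j
  proof -
    \<comment> \<open>The first factor vanishes for \<open>i < k\<close>; \<open>i = k\<close>
      forces \<open>j = k\<close>, and then the second factor is sin 0.\<close>
    have "\<eta> i 0 * s (j - i) 0 = 0" if "i \<le> j" for i
      using that \<open>j < Suc k\<close> zero[of i] by (cases "i = k") (auto simp: s_def)
    then show ?thesis
      unfolding \<theta>_def by (simp add: sum.neutral)
  qed
  moreover have "\<theta> (Suc k) 0 = 1"
  proof -
    \<comment> \<open>Of the two remaining terms, \<open>i = k\<close> gives \<open>Suc k\<close>
      times sin(pi/2), cancelling the denominator of \<open>\<theta>\<close>, and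
      \<open>i = Suc k\<close> contains sin 0.\<close>
    have "(\<Sum>i<k. real (Suc k choose i) * (\<eta> i 0 * s (Suc k - i) 0)) = 0"
      using zero by (intro sum.neutral) auto
    then show ?thesis
      using one by (simp add: \<theta>_def lessThan_Suc_atMost[symmetric] s_def)
  qed
  ultimately show ?case by blast
qed


section \<open>Iterated directional derivatives\<close>

fun iter_deriv :: "'a::real_normed_vector list \<Rightarrow> ('a \<Rightarrow> 'b::real_normed_vector) \<Rightarrow> 'a \<Rightarrow> 'b" where
  "iter_deriv [] f = f"
| "iter_deriv (v # vs) f = (\<lambda>x. frechet_derivative (iter_deriv vs f) (at x) v)"

lemma smooth_on_continuous_on: "smooth_on S f \<Longrightarrow> continuous_on S f"
  unfolding smooth_on_def by (drule spec[of _ 0]) simp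

lemma smooth_on_iter_deriv: "smooth_on S f \<Longrightarrow> smooth_on S (iter_deriv vs f)"
proof (induction vs)
  case (Cons v vs)
  then have "Ck_on (Suc n) (iter_deriv vs f) S" for n
    by (simp add: smooth_on_def)
  then show ?case
    by (simp add: smooth_on_def)
qed simp

lemma smooth_on_has_derivative:
  assumes "smooth_on S f" "x \<in> S"
  shows "(f has_derivative frechet_derivative f (at x)) (at x)"
proof -
  have "Ck_on (Suc 0) f S"
    using assms by (simp only: smooth_on_def)
  then show ?thesis
    using assms(2) by (simp add: frechet_derivative_works[symmetric])
qed

section \<open>Coordinates and exhaustion by compact sets\<close>

text \<open>
  Replaces the basis of the class \<open>euclidean_space\<close>, to which the type need not belong. The spanning
  set \<open>B\<close> may contain \<open>0\<close>, and the coordinates need not be unique.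
\<close>

locale coordinates =
  fixes B :: "'a::real_normed_vector set" and \<phi> :: "'a \<Rightarrow> 'a \<Rightarrow> real"
  assumes finite_B: "finite B"
    and bounded_linear_coord: "\<And>b. b \<in> B \<Longrightarrow> bounded_linear (\<phi> b)"
    and expansion: "\<And>v. (\<Sum>b\<in>B. \<phi> b v *\<^sub>R b) = v"
begin

text \<open>Reduces a Frechet derivative to its values on the finite set \<open>B\<close>, so that
  words over \<open>B\<close> suffice to index higher derivatives.\<close>

lemma linear_expansion:
  assumes "linear L"
  shows "L v = (\<Sum>b\<in>B. \<phi> b v *\<^sub>R L b)"
proof -
  have "L v = L (\<Sum>b\<in>B. \<phi> b v *\<^sub>R b)"
    by (simp only: expansion)
  then show ?thesis
    by (simp add: linear_sum[OF assms] linear_scale[OF assms])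
qed

lemma coord_bound: "\<exists>C>0. \<forall>b\<in>B. \<forall>v. \<bar>\<phi> b v\<bar> \<le> C * norm v"
proof -
  have "\<exists>C>0. \<forall>v. \<bar>\<phi> b v\<bar> \<le> norm v * C" if "b \<in> B" for b
    using bounded_linear.pos_bounded[OF bounded_linear_coord[OF that]] by auto
  then obtain C where C: "\<And>b. b \<in> B \<Longrightarrow> C b > 0" "\<And>b v. b \<in> B \<Longrightarrow> \<bar>\<phi> b v\<bar> \<le> norm v * C b"
    by metis
  have "\<bar>\<phi> b v\<bar> \<le> (1 + (\<Sum>b\<in>B. C b)) * norm v" if b: "b \<in> B" for b v
  proof -
    have "C b \<le> (\<Sum>b\<in>B. C b)"
      using C(1) b finite_B by (intro member_le_sum) (auto intro: less_imp_le)
    then have "norm v * C b \<le> norm v * (1 + (\<Sum>b\<in>B. C b))"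
      by (intro mult_left_mono) auto
    then show ?thesis
      using C(2)[OF b, of v] by (simp add: mult.commute)
  qed
  moreover have "1 + (\<Sum>b\<in>B. C b) > 0"
    using C(1) by (intro add_pos_nonneg sum_nonneg) (auto intro: less_imp_le)
  ultimately show ?thesis by blast
qed

text \<open>Combinations with coefficients in [-M, M] form a continuous image of a product of
  compact sets, one vector being added at a time. The induction takes arbitrary coefficients
  \<open>c\<close>, since \<open>expansion\<close> does not pass to subsets of
  \<open>B\<close>.\<close>

lemma compact_box_exists:
  "\<exists>C. compact C \<and> (\<forall>x. (\<forall>b\<in>B. \<bar>\<phi> b x\<bar> \<le> M) \<longrightarrow> x \<in> C)"
proof -
  have "\<exists>C. compact C \<and> (\<forall>c. (\<forall>b\<in>A. \<bar>c b\<bar> \<le> M) \<longrightarrow> (\<Sum>b\<in>A. c b *\<^sub>R b) \<in> C)" if "finite A" for A :: "'a set"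
    using that
  proof (induction A)
    case empty
    show ?case by (rule exI[of _ "{0}"]) simp
  next
    case (insert a A)
    then obtain C where C: "compact C" "\<And>c. (\<forall>b\<in>A. \<bar>c b\<bar> \<le> M) \<Longrightarrow> (\<Sum>b\<in>A. c b *\<^sub>R b) \<in> C"
      by blast
    let ?C = "(\<lambda>(r, x). r *\<^sub>R a + x) ` ({- M..M} \<times> C)"
    have "compact ?C"
      using C(1) by (intro compact_continuous_image compact_Times)
        (auto simp: case_prod_unfold intro!: continuous_intros)
    moreover have "(\<Sum>b\<in>insert a A. c b *\<^sub>R b) \<in> ?C" if "\<forall>b\<in>insert a A. \<bar>c b\<bar> \<le> M" for c
      using insert.hyps that C(2)[of c]
      by (auto intro!: rev_image_eqI[of "(c a, \<Sum>b\<in>A. c b *\<^sub>R b)"] simp: abs_le_iff)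
    ultimately show ?case by blast
  qed
  from this[OF finite_B] obtain C
    where "compact C" and C: "\<And>c. (\<forall>b\<in>B. \<bar>c b\<bar> \<le> M) \<Longrightarrow> (\<Sum>b\<in>B. c b *\<^sub>R b) \<in> C"
    by blast
  moreover have "x \<in> C" if "\<forall>b\<in>B. \<bar>\<phi> b x\<bar> \<le> M" for x
    using C[of "\<lambda>b. \<phi> b x"] that by (simp add: expansion)
  ultimately show ?thesis by blast
qed

lemma compact_exhaustion:
  assumes "open U"
  shows "\<exists>K :: nat \<Rightarrow> 'a set. (\<forall>k. compact (K k) \<and> K k \<subseteq> U) \<and>
    (\<forall>x\<in>U. \<exists>r>0. \<forall>\<^sub>F k in sequentially. ball x r \<subseteq> K k)"
proof -
  have "\<forall>k::nat. \<exists>C. compact C \<and> (\<forall>x. (\<forall>b\<in>B. \<bar>\<phi> b x\<bar> \<le> real k) \<longrightarrow> x \<in> C)"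
    using compact_box_exists by blast
  then obtain C where C: "\<And>k. compact (C k)" "\<And>k x. (\<forall>b\<in>B. \<bar>\<phi> b x\<bar> \<le> real k) \<Longrightarrow> x \<in> C k"
    by metis
  \<comment> \<open>Intersecting over the points outside \<open>U\<close> handles
    \<open>U = UNIV\<close> as well: the empty intersection imposes no constraint.\<close>
  define K where "K k = C k \<inter> (\<Inter>y\<in>-U. {x. inverse (real (Suc k)) \<le> dist x y})" for k
  have "compact (K k)" for k
    unfolding K_def
    by (intro compact_Int_closed C closed_INT ballI closed_Collect_le continuous_intros)
  moreover have "K k \<subseteq> U" for k
    by (force simp: K_def)
  moreover have "\<exists>r>0. \<forall>\<^sub>F k in sequentially. ball x r \<subseteq> K k" if x: "x \<in> U" for x
  proof -
    \<comment> \<open>The factor 2 keeps every point of \<open>ball x r\<close> at distance more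
      than \<open>r\<close> from the complement of \<open>U\<close>.\<close>
    obtain r where r: "r > 0" "ball x (2 * r) \<subseteq> U"
      using assms x by (metis openE field_sum_of_halves mult_2 mult_2_right half_gt_zero)
    obtain c where c: "c > 0" "\<And>b v. b \<in> B \<Longrightarrow> \<bar>\<phi> b v\<bar> \<le> c * norm v"
      using coord_bound by blast
    have "\<forall>\<^sub>F k in sequentially. inverse (real (Suc k)) < r"
      using LIMSEQ_inverse_real_of_nat r(1) by (rule order_tendstoD)
    moreover have "\<forall>\<^sub>F k in sequentially. c * (norm x + r) \<le> real k"
      by (rule eventually_compose_filterlim[OF eventually_ge_at_top filterlim_real_sequentially])
    ultimately have "\<forall>\<^sub>F k in sequentially. ball x r \<subseteq> K k"
    proof eventually_elim
      case (elim k)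
      show ?case
      proof
        fix z assume z: "z \<in> ball x r"
        have "norm z \<le> norm x + r"
          using z norm_triangle_ineq2[of z x] by (simp add: dist_norm norm_minus_commute)
        then have "c * norm z \<le> real k"
          using elim(2) c(1) by (meson mult_left_mono less_imp_le order_trans)
        then have "z \<in> C k"
          using c(2) by (meson C(2) order_trans)
        moreover have "inverse (real (Suc k)) \<le> dist z y" if "y \<notin> U" for y
        proof -
          have "2 * r \<le> dist x y"
            using that r(2) by (meson mem_ball not_le subsetD)
          also have "\<dots> \<le> dist x z + dist z y"
            by (rule dist_triangle)
          finally show ?thesis
            using z elim(1) by simp
        qed
        ultimately show "z \<in> K k"
          by (simp add: K_def)
      qed
    qed
    then show ?thesis using r(1) by blast
  qed
  ultimately show ?thesis by blast
qed

end

text \<open>For an orthogonal spanning set the Fourier coefficients serve as coordinates; a zero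
  vector in it contributes 0 whatever its coefficient.\<close>

lemma coordinates_exist:
  assumes "finite_dimensional TYPE('a::real_inner)"
  shows "\<exists>(B :: 'a set) \<phi>. coordinates B \<phi>"
proof -
  obtain A :: "'a set" where "finite A" "span A = UNIV"
    using assms by (auto simp: finite_dimensional_def)
  then obtain B where B: "finite B" "span B = (UNIV :: 'a set)" "pairwise orthogonal B"
    using basis_orthogonal by metis
  have "(\<Sum>b\<in>B. (v \<bullet> b / (b \<bullet> b)) *\<^sub>R b) = v" for v
  proof -
    obtain c where c: "v = (\<Sum>b\<in>B. c b *\<^sub>R b)"
      using B span_finite[OF B(1)] by blast
    have "v \<bullet> b = c b * (b \<bullet> b)" if "b \<in> B" for b
    proof -
      have "v \<bullet> b = (\<Sum>b'\<in>B. c b' * (b' \<bullet> b))"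
        by (simp add: c inner_sum_left)
      also have "\<dots> = (\<Sum>b'\<in>B. if b' = b then c b * (b \<bullet> b) else 0)"
        using B(3) that by (intro sum.cong) (auto simp: pairwise_def orthogonal_def)
      finally show ?thesis using that B(1) by simp
    qed
    then have "(v \<bullet> b / (b \<bullet> b)) *\<^sub>R b = c b *\<^sub>R b" if "b \<in> B" for b
      using that by (cases "b = 0") auto
    then have "(\<Sum>b\<in>B. (v \<bullet> b / (b \<bullet> b)) *\<^sub>R b) = (\<Sum>b\<in>B. c b *\<^sub>R b)"
      by (rule sum.cong[OF refl])
    then show ?thesis by (rule trans[OF _ c[symmetric]])
  qed
  moreover have "bounded_linear (\<lambda>v. v \<bullet> b / (b \<bullet> b))" for b :: 'a
    by (intro bounded_linear_compose[OF bounded_linear_divide] bounded_linear_inner_left)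
  ultimately have "coordinates B (\<lambda>b v. v \<bullet> b / (b \<bullet> b))"
    using B(1) by (intro coordinates.intro)
  then show ?thesis by blast
qed


section \<open>Termwise differentiation of the series\<close>

text \<open>Separates convergence from the choice of the terms. In \<open>decay\<close> the radius
  precedes the word and the order, so one ball serves all derivatives; the index from which the
  bound holds may depend on both.\<close>

locale tensor_series = coordinates B \<phi>
  for B :: "'a::real_normed_vector set" and \<phi> +
  fixes U :: "'a set" and g :: "nat \<Rightarrow> 'a \<Rightarrow> real" and H :: "nat \<Rightarrow> nat \<Rightarrow> real \<Rightarrow> real"
  assumes open_U: "open U"
    and smooth_g: "\<And>k. smooth_on U (g k)"
    and H_deriv: "\<And>k j y. (H k j has_real_derivative H k (Suc j) y) (at y)"
    and decay: "\<And>x. x \<in> U \<Longrightarrow> \<exists>r>0. \<forall>vs\<in>lists B. \<forall>j. \<forall>\<^sub>F k in sequentially.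
      \<forall>x'\<in>ball x r. \<forall>y. \<bar>iter_deriv vs (g k) x' * H k j y\<bar> \<le> (1/2) ^ k"
begin

text \<open>Here \<open>H k j\<close> is the \<open>j\<close>-th derivative of the \<open>k\<close>-th factor in \<open>y\<close>.\<close>

definition T :: "'a list \<Rightarrow> nat \<Rightarrow> nat \<Rightarrow> 'a \<times> real \<Rightarrow> real" where
  "T vs j k z = iter_deriv vs (g k) (fst z) * H k j (snd z)"

text \<open>\<open>G [] 0\<close> is the function sought; the others are its formal termwise
  derivatives, identified with the true ones in \<open>G_has_derivative\<close>.\<close>

definition G :: "'a list \<Rightarrow> nat \<Rightarrow> 'a \<times> real \<Rightarrow> real" where
  "G vs j z = (\<Sum>k. T vs j k z)"

text \<open>Weierstrass M-test with a geometric majorant valid from some index on.\<close>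

lemma uniform_limit_G:
  assumes "x \<in> U"
  shows "\<exists>r>0. ball x r \<subseteq> U \<and> (\<forall>vs\<in>lists B. \<forall>j. uniform_limit (ball x r \<times> UNIV)
    (\<lambda>n z. \<Sum>k<n. T vs j k z) (G vs j) sequentially)"
proof -
  obtain r1 where r1: "r1 > 0" and dec: "\<And>vs j. vs \<in> lists B \<Longrightarrow> \<forall>\<^sub>F k in sequentially.
      \<forall>x'\<in>ball x r1. \<forall>y. \<bar>iter_deriv vs (g k) x' * H k j y\<bar> \<le> (1/2) ^ k"
    using decay[OF assms] by blast
  obtain r2 where r2: "r2 > 0" "ball x r2 \<subseteq> U"
    using open_U assms by (meson openE)
  let ?r = "min r1 r2"
  have "uniform_limit (ball x ?r \<times> UNIV)
    (\<lambda>n z. \<Sum>k<n. T vs j k z) (G vs j) sequentially"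
    if "vs \<in> lists B" for vs j
  proof -
    have "\<forall>\<^sub>F k in sequentially. \<forall>z\<in>ball x ?r \<times> UNIV.
        norm (T vs j k z) \<le> (1/2) ^ k"
      using dec[OF that, of j] by eventually_elim (auto simp: T_def)
    then show ?thesis
      unfolding G_def by (rule Weierstrass_m_test_ev) (simp add: summable_geometric)
  qed
  then show ?thesis
    using r1 r2 by (intro exI[of _ ?r]) (auto simp: subset_ball)
qed

lemma H_continuous: "continuous_on UNIV (H k j)"
  by (intro continuous_at_imp_continuous_on ballI DERIV_isCont[OF H_deriv])

lemma continuous_on_G:
  assumes vs: "vs \<in> lists B"
  shows "continuous_on (U \<times> UNIV) (G vs j)"
proof -
  have "isCont (G vs j) z" if z: "z \<in> U \<times> UNIV" for z
  proof -
    have "fst z \<in> U"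
      using z by (simp add: mem_Times_iff)
    then obtain r where r: "r > 0" "ball (fst z) r \<subseteq> U"
      and lim: "uniform_limit (ball (fst z) r \<times> UNIV)
        (\<lambda>n z. \<Sum>k<n. T vs j k z) (G vs j) sequentially"
      using uniform_limit_G vs by blast
    have "continuous_on (ball (fst z) r \<times> UNIV) (T vs j k)" for k
    proof -
      have "continuous_on (ball (fst z) r) (iter_deriv vs (g k))"
        using smooth_on_continuous_on[OF smooth_on_iter_deriv[OF smooth_g]] r(2)
        by (rule continuous_on_subset)
      then show ?thesis
        unfolding T_def
        by (intro continuous_on_mult continuous_on_compose2[OF _ continuous_on_fst]
            continuous_on_compose2[OF H_continuous continuous_on_snd] continuous_on_id) auto
    qed
    then have "continuous_on (ball (fst z) r \<times> UNIV) (G vs j)"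
      by (intro uniform_limit_theorem[OF _ lim] always_eventually allI continuous_on_sum) auto
    moreover have "open (ball (fst z) r \<times> (UNIV :: real set))"
      by (simp add: open_Times)
    moreover have "z \<in> ball (fst z) r \<times> UNIV"
      using r(1) by (simp add: mem_Times_iff)
    ultimately show ?thesis
      using continuous_on_eq_continuous_at by blast
  qed
  then show ?thesis
    by (rule continuous_at_imp_continuous_on[OF ballI])
qed

text \<open>Product rule, with the derivative in \<open>x\<close> expanded along \<open>B\<close> so
  that the result is again expressed by the family \<open>T\<close>.\<close>

lemma term_has_derivative:
  assumes "fst z \<in> U"
  shows "(T vs j k has_derivative
    (\<lambda>v. (\<Sum>b\<in>B. \<phi> b (fst v) * T (b # vs) j k z) + snd v * T vs (Suc j) k z)) (at z)"
proof -
  let ?g = "iter_deriv vs (g k)"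
  let ?g' = "frechet_derivative ?g (at (fst z))"
  have g': "(?g has_derivative ?g') (at (fst z))"
    by (rule smooth_on_has_derivative[OF smooth_on_iter_deriv[OF smooth_g] assms])
  have "(T vs j k has_derivative
      (\<lambda>v. ?g (fst z) * (H k (Suc j) (snd z) * snd v) + ?g' (fst v) * H k j (snd z))) (at z)"
    unfolding T_def
    by (intro has_derivative_mult has_derivative_compose[OF has_derivative_fst[OF has_derivative_ident] g']
        has_derivative_compose[OF has_derivative_snd[OF has_derivative_ident]
          H_deriv[THEN has_field_derivative_imp_has_derivative]])
  also have "(\<lambda>v. ?g (fst z) * (H k (Suc j) (snd z) * snd v) + ?g' (fst v) * H k j (snd z)) =
      (\<lambda>v. (\<Sum>b\<in>B. \<phi> b (fst v) * T (b # vs) j k z) + snd v * T vs (Suc j) k z)"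
    by (rule ext, subst linear_expansion[OF has_derivative_linear[OF g']])
      (simp add: T_def sum_distrib_left sum_distrib_right mult_ac add.commute)
  finally show ?thesis .
qed

text \<open>On the convex set \<open>ball (fst z) r \<times> UNIV\<close> the derivatives of the
  partial sums converge uniformly in operator norm: they combine finitely many uniformly convergent
  series with coefficients bounded by a multiple of \<open>norm v\<close>.\<close>

lemma G_has_derivative:
  assumes vs: "vs \<in> lists B" and z: "z \<in> U \<times> UNIV"
  shows "(G vs j has_derivative
    (\<lambda>v. (\<Sum>b\<in>B. \<phi> b (fst v) * G (b # vs) j z) + snd v * G vs (Suc j) z)) (at z)"
proof -
  have "fst z \<in> U"
    using z by (simp add: mem_Times_iff)
  then obtain r where r: "r > 0" "ball (fst z) r \<subseteq> U"
    and lim: "\<And>vs j. vs \<in> lists B \<Longrightarrow> uniform_limit (ball (fst z) r \<times> UNIV)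
      (\<lambda>n z. \<Sum>k<n. T vs j k z) (G vs j) sequentially"
    using uniform_limit_G by blast
  obtain C where C: "C > 0" "\<And>b v. b \<in> B \<Longrightarrow> \<bar>\<phi> b v\<bar> \<le> C * norm v"
    using coord_bound by blast
  let ?S = "ball (fst z) r \<times> (UNIV :: real set)"
  have open_S: "open ?S" and zS: "z \<in> ?S"
    using r(1) by (simp_all add: open_Times mem_Times_iff)
  have "convex ?S"
    by (intro convex_Times convex_ball convex_UNIV)
  moreover have "(T vs j k has_derivative
      (\<lambda>v. (\<Sum>b\<in>B. \<phi> b (fst v) * T (b # vs) j k w) + snd v * T vs (Suc j) k w)) (at w within ?S)"
    if "w \<in> ?S" for k w
  proof -
    have "fst w \<in> U"
      using that r(2) by (auto simp: mem_Times_iff)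
    then show ?thesis
      by (rule has_derivative_at_withinI[OF term_has_derivative])
  qed
  moreover have "\<forall>\<^sub>F n in sequentially. \<forall>w\<in>?S. \<forall>v.
      norm ((\<Sum>k<n. (\<Sum>b\<in>B. \<phi> b (fst v) * T (b # vs) j k w) + snd v * T vs (Suc j) k w) -
        ((\<Sum>b\<in>B. \<phi> b (fst v) * G (b # vs) j w) + snd v * G vs (Suc j) w)) \<le> e * norm v"
    if "e > 0" for e
  proof -
    let ?m = "real (card B)"
    \<comment> \<open>Each vector of \<open>B\<close> costs \<open>C * \<epsilon>\<close> and the
      \<open>y\<close> direction costs \<open>\<epsilon>\<close>, per unit of
      \<open>norm v\<close>.\<close>
    define \<epsilon> where "\<epsilon> = e / (C * ?m + 1)"
    have m: "C * ?m + 1 > 0"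
      using C(1) by (simp add: add_nonneg_pos)
    then have "\<epsilon> > 0"
      using that by (simp add: \<epsilon>_def)
    have "\<forall>\<^sub>F n in sequentially. \<forall>b\<in>B. \<forall>w\<in>?S. dist (\<Sum>k<n. T (b # vs) j k w) (G (b # vs) j w) < \<epsilon>"
      using vs finite_B by (intro eventually_ball_finite ballI uniform_limitD[OF lim \<open>\<epsilon> > 0\<close>]) auto
    moreover have "\<forall>\<^sub>F n in sequentially. \<forall>w\<in>?S. dist (\<Sum>k<n. T vs (Suc j) k w) (G vs (Suc j) w) < \<epsilon>"
      by (rule uniform_limitD[OF lim[OF vs] \<open>\<epsilon> > 0\<close>])
    ultimately show ?thesis
    proof eventually_elim
      case (elim n)
      show ?case
      proof (intro ballI allI)
        fix w v assume w: "w \<in> ?S"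
        let ?E = "\<lambda>vs j. (\<Sum>k<n. T vs j k w) - G vs j w"
        have "(\<Sum>k<n. (\<Sum>b\<in>B. \<phi> b (fst v) * T (b # vs) j k w) + snd v * T vs (Suc j) k w) -
            ((\<Sum>b\<in>B. \<phi> b (fst v) * G (b # vs) j w) + snd v * G vs (Suc j) w) =
            (\<Sum>b\<in>B. \<phi> b (fst v) * ?E (b # vs) j) + snd v * ?E vs (Suc j)"
          by (simp add: sum.distrib sum_distrib_left right_diff_distrib sum_subtractf
              sum.swap[of _ "{..<n}" B])
        also have "norm \<dots> \<le> (\<Sum>b\<in>B. (C * norm v) * \<epsilon>) + norm v * \<epsilon>"
        proof (intro order.trans[OF norm_triangle_ineq] add_mono order.trans[OF norm_sum] sum_mono)
          fix b assume b: "b \<in> B"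
          have "norm (fst v) \<le> norm v"
            using norm_fst_le[of "fst v" "snd v"] by simp
          then have "\<bar>\<phi> b (fst v)\<bar> \<le> C * norm v"
            using C(2)[OF b, of "fst v"] C(1) by (meson mult_left_mono less_imp_le order_trans)
          then show "norm (\<phi> b (fst v) * ?E (b # vs) j) \<le> (C * norm v) * \<epsilon>"
            using elim(1) b w C(1) unfolding norm_mult
            by (intro mult_mono) (auto simp: dist_norm less_imp_le)
        next
          have "norm (snd v) \<le> norm v"
            using norm_snd_le[of "snd v" "fst v"] by simp
          then show "norm (snd v * ?E vs (Suc j)) \<le> norm v * \<epsilon>"
            using elim(2) w unfolding norm_mult
            by (intro mult_mono) (auto simp: dist_norm less_imp_le)
        qed
        also have "\<dots> = (C * ?m + 1) * \<epsilon> * norm v"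
          by (simp add: algebra_simps)
        also have "\<dots> = e * norm v"
          using m by (simp add: \<epsilon>_def)
        finally show "norm ((\<Sum>k<n. (\<Sum>b\<in>B. \<phi> b (fst v) * T (b # vs) j k w) + snd v * T vs (Suc j) k w) -
            ((\<Sum>b\<in>B. \<phi> b (fst v) * G (b # vs) j w) + snd v * G vs (Suc j) w)) \<le> e * norm v" .
      qed
    qed
  qed
  moreover have sums_G: "(\<lambda>k. T vs j k w) sums G vs j w" if "w \<in> ?S" for w
    using tendsto_uniform_limitI[OF lim[OF vs] that] by (simp add: sums_def)
  ultimately have "\<exists>G'. \<forall>w\<in>?S. (\<lambda>k. T vs j k w) sums G' w \<and> (G' has_derivative
      (\<lambda>v. (\<Sum>b\<in>B. \<phi> b (fst v) * G (b # vs) j w) + snd v * G vs (Suc j) w)) (at w within ?S)"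
    using zS by (intro has_derivative_series[where x = z])
  then obtain G' where G': "\<And>w. w \<in> ?S \<Longrightarrow> (\<lambda>k. T vs j k w) sums G' w"
    and deriv: "(G' has_derivative
      (\<lambda>v. (\<Sum>b\<in>B. \<phi> b (fst v) * G (b # vs) j z) + snd v * G vs (Suc j) z)) (at z within ?S)"
    using zS by blast
  \<comment> \<open>Termwise differentiation yields only some sum function \<open>G'\<close>;
    uniqueness of sums identifies it.\<close>
  have "G' w = G vs j w" if "w \<in> ?S" for w
    using G'[OF that] sums_G[OF that] by (rule sums_unique2)
  moreover have "(G' has_derivative
      (\<lambda>v. (\<Sum>b\<in>B. \<phi> b (fst v) * G (b # vs) j z) + snd v * G vs (Suc j) z)) (at z)"
    using deriv at_within_open[OF zS open_S] by simp
  ultimately show ?thesis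
    using has_derivative_transform_within_open[OF _ open_S zS] by blast
qed

text \<open>In a fixed direction the derivative of a \<open>G\<close> is a combination of other
  \<open>G\<close> with constant coefficients, hence the induction over all words and orders at
  once.\<close>

lemma Ck_on_G: "vs \<in> lists B \<Longrightarrow> Ck_on n (G vs j) (U \<times> UNIV)"
proof (induction n arbitrary: vs j)
  case 0
  then show ?case by (simp add: continuous_on_G)
next
  case (Suc n)
  have open_UR: "open (U \<times> (UNIV :: real set))"
    by (simp add: open_U open_Times)
  show ?case
  proof (rule Ck_on_Suc_has_derivative[OF open_UR G_has_derivative[OF Suc.prems]])
    show "Ck_on n (\<lambda>z. (\<Sum>b\<in>B. \<phi> b (fst v) * G (b # vs) j z) + snd v * G vs (Suc j) z) (U \<times> UNIV)" for v
      using Suc by (intro Ck_on_add Ck_on_sum Ck_on_scaleR[where 'b = real, unfolded real_scaleR_def] open_UR) auto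
  qed
qed

text \<open>Restrict the derivative to a vertical line, where the coordinates of the
  \<open>x\<close> direction vanish. Equality for all \<open>y\<close> is what the induction can
  differentiate.\<close>

lemma higher_deriv_G:
  assumes "x \<in> U"
  shows "(deriv ^^ j) (\<lambda>y. G [] 0 (x, y)) = (\<lambda>y. G [] j (x, y))"
proof (induction j)
  case (Suc j)
  have "((\<lambda>y. G [] j (x, y)) has_real_derivative G [] (Suc j) (x, y)) (at y)" for y
  proof -
    have "((\<lambda>y. (x, y)) has_derivative (\<lambda>h. (0, h))) (at y)"
      by (auto intro!: derivative_eq_intros)
    from has_derivative_compose[OF this G_has_derivative[of "[]" "(x, y)" j]] assms
    have "((\<lambda>y. G [] j (x, y)) has_derivative
        (\<lambda>h. (\<Sum>b\<in>B. \<phi> b 0 * G [b] j (x, y)) + G [] (Suc j) (x, y) * h)) (at y)"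
      by (simp add: mult.commute)
    moreover have "(\<Sum>b\<in>B. \<phi> b 0 * G [b] j (x, y)) = 0"
      using bounded_linear_coord by (intro sum.neutral) (simp add: bounded_linear.linear linear_0)
    ultimately show ?thesis
      by (simp add: has_field_derivative_def)
  qed
  then show ?case
    by (auto simp: Suc intro!: ext DERIV_imp_deriv)
qed simp

end


section \<open>Choice of the scale\<close>

text \<open>Replacing \<open>\<eta> 0 y\<close> by \<open>\<eta> 0 (t * y) / t ^ k\<close> keeps the
  derivative of order \<open>k\<close> at 0 and makes those of lower order O(1/t). Only finitely
  many words and orders are involved, so one \<open>t\<close> suffices.\<close>

lemma small_tower_exists:
  fixes g :: "'a::real_normed_vector \<Rightarrow> real"
  assumes "finite B" "smooth_on U g" "compact K" "K \<subseteq> U"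
  shows "\<exists>H::nat \<Rightarrow> real \<Rightarrow> real.
     (\<forall>j y. (H j has_real_derivative H (Suc j) y) (at y)) \<and>
     (\<forall>j<k. H j 0 = 0) \<and> H k 0 = 1 \<and>
     (\<forall>vs\<in>lists B. length vs \<le> k \<longrightarrow> (\<forall>j<k. \<forall>x\<in>K. \<forall>y. \<bar>iter_deriv vs g x * H j y\<bar> \<le> (1/2) ^ k))"
proof -
  obtain \<eta> :: "nat \<Rightarrow> real \<Rightarrow> real"
    where deriv: "\<And>j y. (\<eta> j has_real_derivative \<eta> (Suc j) y) (at y)"
      and bdd: "\<And>j. \<exists>A. \<forall>y. \<bar>\<eta> j y\<bar> \<le> A"
      and zero: "\<And>j. j < k \<Longrightarrow> \<eta> j 0 = 0" and one: "\<eta> k 0 = 1"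
    using bounded_tower_exists[of k] by blast
  obtain A where A: "\<And>j y. \<bar>\<eta> j y\<bar> \<le> A j"
    using bdd by metis
  have "\<exists>c. \<forall>x\<in>K. \<bar>iter_deriv vs g x\<bar> \<le> c" for vs
  proof -
    have "continuous_on K (iter_deriv vs g)"
      using smooth_on_continuous_on[OF smooth_on_iter_deriv[OF assms(2)]] assms(4)
      by (rule continuous_on_subset)
    then have "bounded (iter_deriv vs g ` K)"
      by (intro compact_imp_bounded compact_continuous_image assms(3))
    then show ?thesis
      by (auto simp: bounded_iff)
  qed
  then obtain c where c: "\<And>vs x. x \<in> K \<Longrightarrow> \<bar>iter_deriv vs g x\<bar> \<le> c vs"
    by metis
  define V where "V = {vs. set vs \<subseteq> B \<and> length vs \<le> k}"
  have fin: "finite V"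
    unfolding V_def by (rule finite_lists_length_le[OF assms(1)])
  \<comment> \<open>Absolute values are taken because \<open>c vs\<close> may be negative when
    \<open>K\<close> is empty.\<close>
  define C where "C = (\<Sum>vs\<in>V. \<bar>c vs\<bar>)"
  define D where "D = (\<Sum>j<k. A j)"
  have A_nonneg: "A j \<ge> 0" for j
    using A[of j 0] by simp
  have "C \<ge> 0" "D \<ge> 0"
    unfolding C_def D_def by (intro sum_nonneg; simp add: A_nonneg)+
  \<comment> \<open>This makes \<open>C * D / t\<close> at most \<open>(1/2) ^ k\<close>; the
    summand 1 ensures \<open>t \<ge> 1\<close>, whence \<open>t ^ j / t ^ k \<le> 1 / t\<close> for
    \<open>j < k\<close>.\<close>
  define t where "t = 1 + C * D * 2 ^ k"
  have t: "t \<ge> 1"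
    using \<open>C \<ge> 0\<close> \<open>D \<ge> 0\<close> by (simp add: t_def)
  \<comment> \<open>A quotient of powers, as the exponent \<open>j - k\<close> can have either
    sign.\<close>
  define H where "H j y = t ^ j / t ^ k * \<eta> j (t * y)" for j y
  have "(H j has_real_derivative H (Suc j) y) (at y)" for j y
    unfolding H_def
    by (rule derivative_eq_intros DERIV_chain2[OF deriv] refl | simp)+
  moreover have "H j 0 = 0" if "j < k" for j
    using zero[OF that] by (simp add: H_def)
  moreover have "H k 0 = 1"
    using one t by (simp add: H_def)
  moreover have "\<bar>iter_deriv vs g x * H j y\<bar> \<le> (1/2) ^ k"
    if vs: "vs \<in> lists B" "length vs \<le> k" and j: "j < k" and x: "x \<in> K" for vs j x y
  proof -
    have "vs \<in> V"
      using vs by (auto simp: V_def)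
    then have "\<bar>c vs\<bar> \<le> C"
      unfolding C_def by (rule member_le_sum) (use fin in auto)
    then have g: "\<bar>iter_deriv vs g x\<bar> \<le> C"
      using c[OF x, of vs] by linarith
    have "A j \<le> D"
      unfolding D_def by (rule member_le_sum) (use j A_nonneg in auto)
    then have \<eta>: "\<bar>\<eta> j (t * y)\<bar> \<le> D"
      using A order_trans by blast
    have "t ^ j * t \<le> t ^ k"
      using power_increasing[of "Suc j" k t] t j by (simp add: mult.commute)
    then have "t ^ j / t ^ k \<le> 1 / t"
      using t by (simp add: field_simps)
    then have "\<bar>H j y\<bar> \<le> 1 / t * D"
      unfolding H_def abs_mult using \<eta> t by (intro mult_mono) auto
    then have "\<bar>iter_deriv vs g x * H j y\<bar> \<le> C * (1 / t * D)"
      unfolding abs_mult using g \<open>C \<ge> 0\<close> by (intro mult_mono) auto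
    also have "\<dots> = C * D / t"
      by simp
    also have "\<dots> \<le> (1/2) ^ k"
      using t by (simp add: divide_simps) (simp add: t_def)
    finally show ?thesis .
  qed
  ultimately show ?thesis by blast
qed

section \<open>Recursive choice of coefficients and scales\<close>

theorem mainTheorem6:
  fixes U :: "'a::real_inner set"
    and f :: "nat \<Rightarrow> 'a \<Rightarrow> real"
  assumes "finite_dimensional TYPE('a)"
    and "open U"
    and "\<And>i. smooth_on U (f i)"
  shows "\<exists>d :: 'a \<times> real \<Rightarrow> real.
           smooth_on (U \<times> UNIV) d \<and>
           (\<forall>k. \<forall>x\<in>U. (deriv ^^ k) (\<lambda>y. d (x, y)) 0 = f k x)"
proof -
  obtain B :: "'a set" and \<phi> where "coordinates B \<phi>"
    using coordinates_exist[OF assms(1)] by blast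
  then interpret coordinates B \<phi> .
  obtain K :: "nat \<Rightarrow> 'a set" where K: "\<And>k. compact (K k)" "\<And>k. K k \<subseteq> U"
    and exhaust: "\<And>x. x \<in> U \<Longrightarrow> \<exists>r>0. \<forall>\<^sub>F k in sequentially. ball x r \<subseteq> K k"
    using compact_exhaustion[OF assms(2)] by metis
  \<comment> \<open>\<open>r\<close> pairs the \<open>k\<close>-th coefficient with the derivatives
    of the \<open>k\<close>-th factor in \<open>y\<close>. The first conjunct solves the
    \<open>k\<close>-th equation of the unitriangular system for the coefficient.\<close>
  define P :: "(nat \<Rightarrow> ('a \<Rightarrow> real) \<times> (nat \<Rightarrow> real \<Rightarrow> real)) \<Rightarrow> nat \<Rightarrow> ('a \<Rightarrow> real) \<times> (nat \<Rightarrow> real \<Rightarrow> real) \<Rightarrow> bool"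
    where "P p k r \<longleftrightarrow>
      fst r = (\<lambda>x. f k x - (\<Sum>i<k. fst (p i) x * snd (p i) k 0)) \<and> smooth_on U (fst r) \<and>
      (\<forall>j y. (snd r j has_real_derivative snd r (Suc j) y) (at y)) \<and>
      (\<forall>j<k. snd r j 0 = 0) \<and> snd r k 0 = 1 \<and>
      (\<forall>vs\<in>lists B. length vs \<le> k \<longrightarrow>
        (\<forall>j<k. \<forall>x\<in>K k. \<forall>y. \<bar>iter_deriv vs (fst r) x * snd r j y\<bar> \<le> (1/2) ^ k))" for p k r
  have "\<exists>p. \<forall>k. P p k (p k)"
  proof (rule dependent_wellorder_choice)
    show "P p k r = P q k r" if "\<And>i. i < k \<Longrightarrow> p i = q i" for p q k r
      using that by (simp add: P_def)
    show "\<exists>r. P p k r" if p: "\<And>i. i < k \<Longrightarrow> P p i (p i)" for p k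
    proof -
      define g where "g = (\<lambda>x. f k x - (\<Sum>i<k. fst (p i) x * snd (p i) k 0))"
      have "smooth_on U (fst (p i))" if "i < k" for i
        using p[OF that] unfolding P_def by blast
      \<comment> \<open>The subtraction is rewritten as a sum of scalar multiples to fit the closure
        lemmas.\<close>
      then have "Ck_on n (\<lambda>x. f k x + (\<Sum>i<k. (- snd (p i) k 0) *\<^sub>R fst (p i) x)) U" for n
        using assms(3) by (intro Ck_on_add Ck_on_sum Ck_on_scaleR assms(2)) (auto simp: smooth_on_def)
      then have g: "smooth_on U g"
        by (simp add: smooth_on_def g_def sum_negf mult.commute)
      from small_tower_exists[OF finite_B g K, of k k] obtain H :: "nat \<Rightarrow> real \<Rightarrow> real"
        where "\<forall>j y. (H j has_real_derivative H (Suc j) y) (at y)" "\<forall>j<k. H j 0 = 0" "H k 0 = 1"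
          "\<forall>vs\<in>lists B. length vs \<le> k \<longrightarrow>
            (\<forall>j<k. \<forall>x\<in>K k. \<forall>y. \<bar>iter_deriv vs g x * H j y\<bar> \<le> (1/2) ^ k)"
        by (elim exE conjE)
      then have "P p k (g, H)"
        unfolding P_def fst_conv snd_conv by (intro conjI g_def g)
      then show ?thesis ..
    qed
  qed
  then obtain p where p: "\<And>k. P p k (p k)"
    by blast
  define g where "g k = fst (p k)" for k
  define H where "H k = snd (p k)" for k
  have "g k = (\<lambda>x. f k x - (\<Sum>i<k. g i x * H i k 0))" for k
    using p[of k] unfolding P_def g_def H_def by blast
  then have g_eq: "g k x = f k x - (\<Sum>i<k. g i x * H i k 0)" for k x
    by (rule fun_cong)
  have smooth: "smooth_on U (g k)"
    and tower: "(H k j has_real_derivative H k (Suc j) y) (at y)"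
    and H0: "H k k 0 = 1" "j < k \<Longrightarrow> H k j 0 = 0" for j k y
    using p[of k] unfolding P_def g_def H_def by blast+
  have small: "\<bar>iter_deriv vs (g k) x * H k j y\<bar> \<le> (1/2) ^ k"
    if "vs \<in> lists B" "length vs \<le> k" "j < k" "x \<in> K k" for vs k j x y
    using p[of k] that unfolding P_def g_def H_def by blast
  interpret tensor_series B \<phi> U g H
  proof
    show "\<exists>r>0. \<forall>vs\<in>lists B. \<forall>j. \<forall>\<^sub>F k in sequentially.
      \<forall>x'\<in>ball x r. \<forall>y. \<bar>iter_deriv vs (g k) x' * H k j y\<bar> \<le> (1/2) ^ k" if "x \<in> U" for x
    proof -
      obtain r where r: "r > 0" "\<forall>\<^sub>F k in sequentially. ball x r \<subseteq> K k"
        using exhaust[OF \<open>x \<in> U\<close>] by blast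
      have "\<forall>\<^sub>F k in sequentially. \<forall>x'\<in>ball x r. \<forall>y. \<bar>iter_deriv vs (g k) x' * H k j y\<bar> \<le> (1/2) ^ k"
        if "vs \<in> lists B" for vs j
        \<comment> \<open>A fixed word and order fall under the bound \<open>small\<close> once
          \<open>k\<close> is at least the length and exceeds \<open>j\<close>.\<close>
        using r(2) eventually_ge_at_top[of "length vs"] eventually_gt_at_top[of j]
        by eventually_elim (use small that in blast)
      then show ?thesis
        using r(1) by blast
    qed
  qed (fact assms(2) smooth tower)+
  have "smooth_on (U \<times> UNIV) (G [] 0)"
    by (simp add: smooth_on_def Ck_on_G)
  moreover have "(deriv ^^ k) (\<lambda>y. G [] 0 (x, y)) 0 = f k x" if "x \<in> U" for k x
  proof -
    have "(deriv ^^ k) (\<lambda>y. G [] 0 (x, y)) 0 = (\<Sum>i. g i x * H i k 0)"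
      by (simp only: higher_deriv_G[OF that]) (simp add: G_def T_def)
    \<comment> \<open>Factors with index above \<open>k\<close> have vanishing derivative of order
      \<open>k\<close> at 0. The last term left is \<open>g k x\<close>, and \<open>g_eq\<close>
      then gives \<open>f k x\<close>.\<close>
    also have "\<dots> = (\<Sum>i<Suc k. g i x * H i k 0)"
      by (rule suminf_finite) (auto simp: H0)
    also have "\<dots> = f k x"
      using g_eq[of k x] by (simp add: H0)
    finally show ?thesis .
  qed
  ultimately show ?thesis by blast
qed

end
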